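(* Let $y=(y^a_{\mu\nu})$, $1\le a\le N_c^2-1$, $1\le\mu,\nu\le4$, be the real dimensionless Halpern field, antisymmetric in $\mu,\nu$, distributed according to a probability measure $d\mu_{\rm EL}(y)$ for which the moments below are finite, and let $X_+=(y^+)^2$, $X_-=(y^-)^2$ be the squared norms of its self-dual and anti-self-dual components. Let $g\in\mathbb{R}$, $\Lambda_{\rm EL}>0$, and let the pure-glue topological stiffness be $$A_{\rm F}=\Lambda_{\rm EL}^4\left[\langle q_\chi^2\rangle_{\rm EL}-\langle q_\chi\rangle_{\rm EL}^2\right],\qquad q_\chi(y)=\frac{g^2}{32\pi^2}\sum_{a,\mu,\nu}y^a_{\mu\nu}\widetilde y^{a}_{\mu\nu}.$$ Then $$A_{\rm F}=\Lambda_{\rm EL}^4\left(\frac{g^2}{32\pi^2}\right)^2{\rm Var}_{\rm EL}(X_+-X_-).$$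
   Context: Euclidean signature is used. The dual is $\widetilde y^a_{\mu\nu}=\frac12\sum_{\rho,\sigma}\epsilon_{\mu\nu\rho\sigma}y^a_{\rho\sigma}$, with $\epsilon$ the totally antisymmetric symbol, $\epsilon_{1234}=1$. The self-dual and anti-self-dual parts are $y^{a,\pm}_{\mu\nu}=\frac12(y^a_{\mu\nu}\pm\widetilde y^a_{\mu\nu})$, and $(y^\pm)^2=\sum_{a,\mu,\nu}y^{a,\pm}_{\mu\nu}y^{a,\pm}_{\mu\nu}$. $\langle\cdot\rangle_{\rm EL}$ and ${\rm Var}_{\rm EL}$ denote expectation and variance with respect to $d\mu_{\rm EL}$. *)

theory Defs
  imports "HOL-Probability.Probability" "HOL-Combinatorics.Permutations"
begin

text \<open>
  A field configuration is written \<open>y $ a $ \<mu> $ \<nu>\<close>, with colour index \<open>a :: 'c\<close> and space-time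
  indices \<open>\<mu>, \<nu> :: 4\<close>.  The four elements of the index type are \<open>1, 2, 3, 4\<close>, where \<open>4 = 0\<close>; only
  the labels matter, the order of the type is never used.
\<close>

type_synonym 'c field_config = "real ^ 4 ^ 4 ^ 'c"

definition halpern_fields :: "'c::finite field_config set" where
  "halpern_fields = {y. \<forall>a \<mu> \<nu>. y $ a $ \<mu> $ \<nu> = - (y $ a $ \<nu> $ \<mu>)}"

definition levi_civita :: "4 \<Rightarrow> 4 \<Rightarrow> 4 \<Rightarrow> 4 \<Rightarrow> real" where
  "levi_civita \<mu> \<nu> \<rho> \<sigma> =
     (if distinct [\<mu>, \<nu>, \<rho>, \<sigma>]
      then of_int (sign (id(1 := \<mu>, 2 := \<nu>, 3 := \<rho>, 4 := \<sigma>)))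
      else 0)"

definition dual :: "'c::finite field_config \<Rightarrow> 'c field_config" where
  "dual y = (\<chi> a \<mu> \<nu>. 1/2 * (\<Sum>\<rho>\<in>UNIV. \<Sum>\<sigma>\<in>UNIV. levi_civita \<mu> \<nu> \<rho> \<sigma> * y $ a $ \<rho> $ \<sigma>))"

definition self_dual_part :: "'c::finite field_config \<Rightarrow> 'c field_config" where
  "self_dual_part y = (1/2) *\<^sub>R (y + dual y)"

definition anti_self_dual_part :: "'c::finite field_config \<Rightarrow> 'c field_config" where
  "anti_self_dual_part y = (1/2) *\<^sub>R (y - dual y)"

definition contraction :: "'c::finite field_config \<Rightarrow> 'c field_config \<Rightarrow> real" where
  "contraction y z = (\<Sum>a\<in>UNIV. \<Sum>\<mu>\<in>UNIV. \<Sum>\<nu>\<in>UNIV. y $ a $ \<mu> $ \<nu> * z $ a $ \<mu> $ \<nu>)"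

definition X_plus :: "'c::finite field_config \<Rightarrow> real" where
  "X_plus y = contraction (self_dual_part y) (self_dual_part y)"

definition X_minus :: "'c::finite field_config \<Rightarrow> real" where
  "X_minus y = contraction (anti_self_dual_part y) (anti_self_dual_part y)"

definition q_chi :: "real \<Rightarrow> 'c::finite field_config \<Rightarrow> real" where
  "q_chi g y = g\<^sup>2 / (32 * pi\<^sup>2) * contraction y (dual y)"

definition topological_stiffness :: "'c::finite field_config measure \<Rightarrow> real \<Rightarrow> real \<Rightarrow> real" where
  "topological_stiffness M g \<Lambda> =
     \<Lambda> ^ 4 * (prob_space.expectation M (\<lambda>y. (q_chi g y)\<^sup>2)
              - (prob_space.expectation M (q_chi g))\<^sup>2)"

lemma levi_civita_1234: "levi_civita 1 2 3 4 = 1"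
proof -
  have "id(1 := 1, 2 := 2, 3 := 3, 4 := 4 :: 4) = id"
    by (auto simp: fun_eq_iff)
  then show ?thesis
    by (simp add: levi_civita_def)
qed

lemma levi_civita_antisym:
 "levi_civita n m r s = - levi_civita m n r s"
 "levi_civita m r n s = - levi_civita m n r s"
 "levi_civita m n s r = - levi_civita m n r s"
proof -
  have P: "permutation (id(1 := m, 2 := n, 3 := r, 4 := s))" if "distinct [m,n,r,s::4]" for m n r s
  proof -
    have "inj (id(1 := m, 2 := n, 3 := r, 4 := s))"
      unfolding inj_def forall_4 using that by auto
    then show ?thesis unfolding permutation bij_def by (intro conjI finite finite_UNIV_inj_surj)
  qed
  have S: "sign (p \<circ> Transposition.transpose a b) = - sign p" if "permutation p" "a \<noteq> b" for p and a b::4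
    using that by (simp add: sign_compose permutation_swap_id sign_swap_id)
  show "levi_civita n m r s = - levi_civita m n r s"
  proof (cases "distinct [m,n,r,s]")
    case True
    have "id(1 := n, 2 := m, 3 := r, 4 := s) = id(1 := m, 2 := n, 3 := r, 4 := s) \<circ> Transposition.transpose 1 2"
      unfolding fun_eq_iff forall_4 by (auto simp: Transposition.transpose_def)
    then show ?thesis using True S[OF P[OF True], of 1 2] by (auto simp: levi_civita_def)
  qed (auto simp: levi_civita_def)
  show "levi_civita m r n s = - levi_civita m n r s"
  proof (cases "distinct [m,n,r,s]")
    case True
    have "id(1 := m, 2 := r, 3 := n, 4 := s) = id(1 := m, 2 := n, 3 := r, 4 := s) \<circ> Transposition.transpose 2 3"
      unfolding fun_eq_iff forall_4 by (auto simp: Transposition.transpose_def)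
    then show ?thesis using True S[OF P[OF True], of 2 3] by (auto simp: levi_civita_def)
  qed (auto simp: levi_civita_def)
  show "levi_civita m n s r = - levi_civita m n r s"
  proof (cases "distinct [m,n,r,s]")
    case True
    have "id(1 := m, 2 := n, 3 := s, 4 := r) = id(1 := m, 2 := n, 3 := r, 4 := s) \<circ> Transposition.transpose 3 4"
      unfolding fun_eq_iff forall_4 by (auto simp: Transposition.transpose_def)
    then show ?thesis using True S[OF P[OF True], of 3 4] by (auto simp: levi_civita_def)
  qed (auto simp: levi_civita_def)
qed

end

theory Submission
  imports Defs
begin

text \<open>
  Polarization: expanding the squares of \<open>y \<plusminus> dual y\<close>, the diagonal terms cancel in the difference
  and the cross terms add up to the contraction of \<open>y\<close> with its dual.  Hence \<open>q_chi\<close> is a constant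
  multiple of \<open>X_plus - X_minus\<close>, and the variance scales by the square of that constant.
\<close>

lemma X_plus_minus_X_minus: "X_plus y - X_minus y = contraction y (dual y)"
  unfolding X_plus_def X_minus_def contraction_def self_dual_part_def anti_self_dual_part_def
    sum_subtractf[symmetric]
  \<comment> \<open>With both sides as one triple sum, the identity holds entrywise: ((u + v)/2)^2 -
    ((u - v)/2)^2 = u * v.\<close>
  by (intro sum.cong refl) (simp add: field_simps)


theorem proposition3:
  fixes M :: "'c::finite field_config measure"
    and N\<^sub>c :: nat and g \<Lambda> :: real
  assumes colours: "CARD('c) = N\<^sub>c\<^sup>2 - 1"
    and prob: "prob_space M"
    and halpern: "sets M = sets (restrict_space borel halpern_fields)"
    and Lambda_pos: "\<Lambda> > 0"
    and q_moments: "integrable M (q_chi g)" "integrable M (\<lambda>y. (q_chi g y)\<^sup>2)"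
    and X_moments: "integrable M (\<lambda>y. X_plus y - X_minus y)"
                   "integrable M (\<lambda>y. (X_plus y - X_minus y)\<^sup>2)"
  shows "topological_stiffness M g \<Lambda> =
           \<Lambda> ^ 4 * (g\<^sup>2 / (32 * pi\<^sup>2))\<^sup>2 * prob_space.variance M (\<lambda>y. X_plus y - X_minus y)"
proof -
  interpret prob_space M by (rule prob)
  define c where "c = g\<^sup>2 / (32 * pi\<^sup>2)"
  \<comment> \<open>An equality of functions, so that it also rewrites the unapplied integrand
    \<open>q_chi g\<close> of the mean.\<close>
  have q: "q_chi g = (\<lambda>y. c * (X_plus y - X_minus y))"
    by (simp add: fun_eq_iff q_chi_def c_def X_plus_minus_X_minus)
  show ?thesis
    \<comment> \<open>\<open>variance_eq\<close> gives the variance the shape of the stiffness,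
      second moment minus squared mean; both terms on the left then carry the factor
      \<open>c\<^sup>2\<close>.\<close>
    unfolding topological_stiffness_def q variance_eq[OF X_moments] power_mult_distrib
      integral_mult_right_zero c_def[symmetric]
    by (simp only: right_diff_distrib mult.assoc)
qed

end
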